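(* Let $g$ be a derivator, $\mathbb F\in\{\mathbb R,\mathbb C\}$, let $X$ be a compact subset of $\mathbb R_+$ and let $Y\subset\operatorname{C}_g(X,\mathbb F)$ be a finite-dimensional vector subspace. Then $Y$ is a Chebyshev space (in $\operatorname{C}_g(X,\mathbb F)$ with the supremum norm) if and only if $Y$ is a $g$-Haar space.
   Context: A derivator is a left-continuous nondecreasing function $g:\mathbb R\to\mathbb R$. Write $g(t^+)$ for the right-hand limit and $D_g=\{t\in\mathbb R:g(t^+)>g(t)\}$. $\mathbb R_+$ is the disjoint union of $\mathbb R$ and a formal copy $\{t^+:t\in D_g\}$ of $D_g$; $g$ is extended to $\mathbb R_+$ by letting $g(t^+)$ be the right-hand limit of $g$ at $t$. $\mathbb R_+$ carries the pseudometric $d_g(x,y)=|g(x)-g(y)|$ and its topology. Points $x,y\in\mathbb R_+$ are $g$-distinct if $g(x)\neq g(y)$. $\operatorname{C}_g(X,\mathbb F)$ is the space of functions $X\to\mathbb F$ continuous for this topology. A vector subspace $Y$ of a normed space $V$ is a Chebyshev space if for every $v\in V$ there is a unique $y\in Y$ with $\|v-y\|=\inf_{w\in Y}\|v-w\|$. A subspace $Y\subset\operatorname{C}_g(X,\mathbb F)$ of finite dimension $d$ is a $g$-Haar space if for every set $T=\{y_1,\dots,y_d\}\subset X$ of $d$ pairwise $g$-distinct points the mapping $Y\to\mathbb F^d$, $f\mapsto(f(y_1),\dots,f(y_d))$, is an isomorphism of vector spaces. *)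

theory Defs
  imports "HOL-Analysis.Analysis" "HOL-Library.Function_Algebras"
begin

definition derivator :: "(real \<Rightarrow> real) \<Rightarrow> bool" where
  "derivator g \<longleftrightarrow> mono g \<and> (\<forall>t. continuous (at_left t) g)"

definition right_lim :: "(real \<Rightarrow> real) \<Rightarrow> real \<Rightarrow> real" where
  "right_lim g t = Lim (at_right t) g"

definition jump_set :: "(real \<Rightarrow> real) \<Rightarrow> real set" where
  "jump_set g = {t. right_lim g t > g t}"

text \<open>\<open>RPlus t\<close> is the formal point \<open>t\<^sup>+\<close>. The type contains such a point for every real \<open>t\<close>;
  only those with \<open>t\<close> in the jump set belong to the extended line \<open>ext_line g\<close>.\<close>

datatype ext_pt = Pt real | RPlus real

definition ext_line :: "(real \<Rightarrow> real) \<Rightarrow> ext_pt set" where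
  "ext_line g = range Pt \<union> RPlus ` jump_set g"

fun ext_fun :: "(real \<Rightarrow> real) \<Rightarrow> ext_pt \<Rightarrow> real" where
  "ext_fun g (Pt t) = g t"
| "ext_fun g (RPlus t) = right_lim g t"

definition g_dist :: "(real \<Rightarrow> real) \<Rightarrow> ext_pt \<Rightarrow> ext_pt \<Rightarrow> real" where
  "g_dist g x y = \<bar>ext_fun g x - ext_fun g y\<bar>"

definition g_topology :: "(real \<Rightarrow> real) \<Rightarrow> ext_pt topology" where
  "g_topology g = topology (\<lambda>U. U \<subseteq> ext_line g \<and>
     (\<forall>x\<in>U. \<exists>e>0. {y \<in> ext_line g. g_dist g x y < e} \<subseteq> U))"

lemma openin_g_topology:
  "openin (g_topology g) U \<longleftrightarrow> U \<subseteq> ext_line g \<and>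
     (\<forall>x\<in>U. \<exists>e>0. {y \<in> ext_line g. g_dist g x y < e} \<subseteq> U)"
proof -
  let ?L = "\<lambda>U. U \<subseteq> ext_line g \<and> (\<forall>x\<in>U. \<exists>e>0. {y \<in> ext_line g. g_dist g x y < e} \<subseteq> U)"
  have inter: "?L (S \<inter> T)" if S: "?L S" and T: "?L T" for S T
  proof (intro conjI ballI)
    show "S \<inter> T \<subseteq> ext_line g" using S by blast
    fix x assume "x \<in> S \<inter> T"
    then obtain d e where "d > 0" "{y \<in> ext_line g. g_dist g x y < d} \<subseteq> S"
      and "e > 0" "{y \<in> ext_line g. g_dist g x y < e} \<subseteq> T"
      using S T by blast
    then show "\<exists>e>0. {y \<in> ext_line g. g_dist g x y < e} \<subseteq> S \<inter> T"
      by (intro exI[of _ "min d e"]) auto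
  qed
  have union: "?L (\<Union>K)" if "\<forall>S\<in>K. ?L S" for K
    using that by (meson Sup_least UnionE Union_upper subset_trans)
  have "istopology ?L"
    unfolding istopology_def using inter union by blast
  then show ?thesis
    by (simp add: g_topology_def topology_inverse')
qed

lemma topspace_g_topology [simp]: "topspace (g_topology g) = ext_line g"
proof
  show "topspace (g_topology g) \<subseteq> ext_line g"
    by (auto simp: topspace_def openin_g_topology)
  have "openin (g_topology g) (ext_line g)"
    by (auto simp: openin_g_topology intro: exI[of _ 1])
  then show "ext_line g \<subseteq> topspace (g_topology g)"
    by (rule openin_subset)
qed

definition fun_scale :: "'a::field \<Rightarrow> ('b \<Rightarrow> 'a) \<Rightarrow> 'b \<Rightarrow> 'a" where
  "fun_scale c f = (\<lambda>x. c * f x)"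

global_interpretation fun_space: vector_space "fun_scale :: 'a::field \<Rightarrow> ('b \<Rightarrow> 'a) \<Rightarrow> 'b \<Rightarrow> 'a"
  by unfold_locales (auto simp: fun_scale_def fun_eq_iff algebra_simps)

definition finite_dim :: "('b \<Rightarrow> 'a::field) set \<Rightarrow> bool" where
  "finite_dim Y \<longleftrightarrow> (\<exists>B. finite B \<and> fun_space.span B = Y)"

definition fun_space_iso ::
    "('b \<Rightarrow> 'a::field) set \<Rightarrow> ('c \<Rightarrow> 'a) set \<Rightarrow> (('b \<Rightarrow> 'a) \<Rightarrow> ('c \<Rightarrow> 'a)) \<Rightarrow> bool" where
  "fun_space_iso V W \<phi> \<longleftrightarrow>
     (\<forall>f\<in>V. \<forall>h\<in>V. \<phi> (f + h) = \<phi> f + \<phi> h) \<and>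
     (\<forall>c. \<forall>f\<in>V. \<phi> (fun_scale c f) = fun_scale c (\<phi> f)) \<and>
     bij_betw \<phi> V W"

text \<open>The coordinate space \<open>F\<^sup>d\<close>, as the sequences vanishing from index \<open>d\<close> on.\<close>

definition coord_space :: "nat \<Rightarrow> (nat \<Rightarrow> 'a::field) set" where
  "coord_space d = {c. \<forall>i\<ge>d. c i = 0}"

text \<open>A function on \<open>X\<close> is represented by its extension by zero, so that the pointwise
  operations of the function type are those of the function space on \<open>X\<close>.
  Continuity is imposed on \<open>X\<close> only.\<close>

definition C_g :: "(real \<Rightarrow> real) \<Rightarrow> ext_pt set \<Rightarrow> (ext_pt \<Rightarrow> 'a::real_normed_field) set" where
  "C_g g X = {f. continuous_map (subtopology (g_topology g) X) euclidean f \<and> (\<forall>x. x \<notin> X \<longrightarrow> f x = 0)}"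

text \<open>Inserting \<open>0\<close> only matters for empty \<open>X\<close>, where the norm has to be \<open>0\<close>.\<close>

definition sup_norm :: "'b set \<Rightarrow> ('b \<Rightarrow> 'a::real_normed_vector) \<Rightarrow> real" where
  "sup_norm X f = Sup (insert 0 ((\<lambda>x. norm (f x)) ` X))"

definition chebyshev_space ::
    "('b \<Rightarrow> 'a::field) set \<Rightarrow> (('b \<Rightarrow> 'a) \<Rightarrow> real) \<Rightarrow> ('b \<Rightarrow> 'a) set \<Rightarrow> bool" where
  "chebyshev_space V N Y \<longleftrightarrow>
     fun_space.subspace Y \<and> Y \<subseteq> V \<and>
     (\<forall>v\<in>V. \<exists>!y. y \<in> Y \<and> N (v - y) = (INF w\<in>Y. N (v - w)))"

definition g_distinct :: "(real \<Rightarrow> real) \<Rightarrow> ext_pt \<Rightarrow> ext_pt \<Rightarrow> bool" where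
  "g_distinct g x y \<longleftrightarrow> ext_fun g x \<noteq> ext_fun g y"

definition g_haar_space ::
    "(real \<Rightarrow> real) \<Rightarrow> ext_pt set \<Rightarrow> (ext_pt \<Rightarrow> 'a::real_normed_field) set \<Rightarrow> bool" where
  "g_haar_space g X Y \<longleftrightarrow>
     fun_space.subspace Y \<and> Y \<subseteq> C_g g X \<and> finite_dim Y \<and>
     (let d = fun_space.dim Y in
       \<forall>y :: nat \<Rightarrow> ext_pt.
         (\<forall>i<d. y i \<in> X) \<and> (\<forall>i<d. \<forall>j<d. i \<noteq> j \<longrightarrow> g_distinct g (y i) (y j)) \<longrightarrow>
         fun_space_iso Y (coord_space d) (\<lambda>f i. if i < d then f (y i) else 0))"

end

theory Submission
  imports Defs
begin

text \<open>
  Continuous functions do not separate points that are not \<open>g\<close>-distinct, so everything takes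
  place on the compact set of values of \<open>g\<close> on \<open>X\<close>, and Haar's classical argument applies.

  If \<open>Y\<close> is a Haar space of dimension \<open>d\<close>, a minimizing sequence is bounded at \<open>d\<close> nodes; a
  subsequence converges at the nodes and hence, by Lagrange interpolation, everywhere. If \<open>y\<close>
  and \<open>z\<close> are best approximations of \<open>v\<close>, so is their midpoint \<open>p\<close>, and strict convexity of the
  norm of the field makes \<open>y\<close> and \<open>z\<close> agree wherever \<open>|v - p|\<close> is maximal. If these extremal points
  include \<open>d\<close> nodes then \<open>y = z\<close>; otherwise some \<open>q \<in> Y\<close> interpolates \<open>v - p\<close> at all of them, and
  \<open>p + t q\<close> is a strictly better approximation for small \<open>t > 0\<close>.

  If \<open>Y\<close> is not a Haar space, there are \<open>d\<close> nodes \<open>y\<^sub>i\<close>, a nonzero \<open>h \<in> Y\<close> vanishing at them with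
  \<open>|h| \<le> 1\<close>, and a nontrivial relation \<open>\<Sum> a\<^sub>i f(y\<^sub>i) = 0\<close> on \<open>Y\<close>. Let \<open>u\<close> be continuous with
  \<open>|u| \<le> 1\<close> and \<open>a\<^sub>i u(y\<^sub>i) = |a\<^sub>i|\<close>. The relation shows that \<open>v = u (1 - |h|)\<close> has distance at least
  \<open>1\<close> from \<open>Y\<close>, and both \<open>0\<close> and \<open>h\<close> attain it.
\<close>

section \<open>Linear algebra of evaluation maps\<close>

context vector_space_pair
begin

text \<open>Dimension count by the exchange bound. If \<open>f\<close> is injective,
  \<open>f\<close> applied to \<open>B\<close> gives an independent family as large as
  \<open>C\<close>, which no element of \<open>C\<close> can enlarge. If \<open>f\<close> is
  surjective, the images of \<open>B\<close> span a space of dimension \<open>card C\<close>, so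
  they are distinct and independent. This is what reduces bijectivity of an evaluation map to
  injectivity.\<close>

lemma inj_on_span_iff_surj:
  assumes f: "Vector_Spaces.linear s1 s2 f"
    and B: "vs1.independent B" "finite B"
    and C: "vs2.independent C" "finite C"
    and card: "card B = card C"
    and sub: "f ` B \<subseteq> vs2.span C"
  shows "inj_on f (vs1.span B) \<longleftrightarrow> f ` vs1.span B = vs2.span C"
proof -
  have image: "f ` vs1.span B = vs2.span (f ` B)"
    using f by (simp add: linear_span_image)
  show ?thesis
  proof
    assume inj: "inj_on f (vs1.span B)"
    have ind: "vs2.independent (f ` B)"
      by (rule linear_independent_injective_image[OF f B(1) inj])
    have "inj_on f B"
      using inj by (rule inj_on_subset) (rule vs1.span_superset)
    then have cardB: "card (f ` B) = card C"
      using card by (simp add: card_image)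
    have "c \<in> vs2.span (f ` B)" if "c \<in> C" for c
    proof (rule ccontr)
      assume c: "c \<notin> vs2.span (f ` B)"
      have "card (insert c (f ` B)) \<le> card C"
        using vs2.independent_span_bound[OF C(2) vs2.independent_insertI[OF c ind]]
          sub that vs2.span_base by blast
      moreover have "c \<notin> f ` B"
        using c vs2.span_base by blast
      ultimately show False
        using cardB B(2) by simp
    qed
    then have "vs2.span C \<subseteq> vs2.span (f ` B)"
      by (intro vs2.span_minimal) auto
    moreover have "vs2.span (f ` B) \<subseteq> vs2.span C"
      using sub by (intro vs2.span_minimal) auto
    ultimately show "f ` vs1.span B = vs2.span C"
      using image by simp
  next
    assume surj: "f ` vs1.span B = vs2.span C"
    \<comment> \<open>Any \<open>D\<close> whose span contains the images of \<open>B\<close> also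
      spans \<open>C\<close>, so the exchange bound makes such a \<open>D\<close> at least as large
      as \<open>C\<close>. Below, dropping a redundant image contradicts this.\<close>
    have C_sub: "C \<subseteq> vs2.span D" if "f ` B \<subseteq> vs2.span D" for D
    proof -
      have "vs2.span (f ` B) \<subseteq> vs2.span D"
        using that by (intro vs2.span_minimal) auto
      then show ?thesis
        using vs2.span_superset[of C] surj image by auto
    qed
    have "card C \<le> card (f ` B)"
      using vs2.independent_span_bound[of "f ` B" C] C B C_sub vs2.span_superset by auto
    then have "inj_on f B"
      using card B(2) card_image_le[OF B(2), of f] by (auto intro: eq_card_imp_inj_on)
    moreover have "vs2.independent (f ` B)"
    proof
      assume "vs2.dependent (f ` B)"
      then obtain b where b: "b \<in> f ` B" "b \<in> vs2.span (f ` B - {b})"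
        by (auto simp: vs2.dependent_def)
      have "f ` B \<subseteq> vs2.span (f ` B - {b})"
        using b(2) vs2.span_base[of _ "f ` B - {b}"] by blast
      then have "card C \<le> card (f ` B - {b})"
        using vs2.independent_span_bound[of "f ` B - {b}" C] C B C_sub by auto
      also have "\<dots> < card (f ` B)"
        using b(1) B(2) by (intro psubset_card_mono) auto
      also have "\<dots> \<le> card B"
        using B(2) by (rule card_image_le)
      finally show False
        using card by simp
    qed
    ultimately show "inj_on f (vs1.span B)"
      using linear_inj_on_span_independent_image[OF f] by blast
  qed
qed

end

global_interpretation fun_pair: vector_space_pair
  "fun_scale :: 'a::field \<Rightarrow> ('b \<Rightarrow> 'a) \<Rightarrow> 'b \<Rightarrow> 'a"
  "fun_scale :: 'a::field \<Rightarrow> ('c \<Rightarrow> 'a) \<Rightarrow> 'c \<Rightarrow> 'a"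
  by unfold_locales

text \<open>The field as a space over itself, so that linear functionals on function spaces are
  available.\<close>

global_interpretation fun_dual: vector_space_pair
  "fun_scale :: 'a::field \<Rightarrow> ('b \<Rightarrow> 'a) \<Rightarrow> 'b \<Rightarrow> 'a" "(*) :: 'a \<Rightarrow> 'a \<Rightarrow> 'a"
  by unfold_locales (auto simp: algebra_simps)

lemma fun_scale_apply [simp]: "fun_scale c f x = c * f x"
  by (simp add: fun_scale_def)

lemma sum_fun_apply: "(\<Sum>i\<in>I. f i) x = (\<Sum>i\<in>I. f i x)"
  by (induction I rule: infinite_finite_induct) auto

section \<open>Coordinate spaces on a finite index set\<close>

definition unit_vec :: "'b \<Rightarrow> 'b \<Rightarrow> 'a::field" where
  "unit_vec i = (\<lambda>x. if x = i then 1 else 0)"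

lemma inj_unit_vec: "inj (unit_vec :: 'b \<Rightarrow> 'b \<Rightarrow> 'a::field)"
  by (rule injI) (metis unit_vec_def zero_neq_one)

lemma card_unit_vec [simp]: "card (unit_vec ` I :: ('b \<Rightarrow> 'a::field) set) = card I"
  using inj_on_subset[OF inj_unit_vec subset_UNIV] by (rule card_image)

lemma unit_vec_expansion:
  fixes f :: "'b \<Rightarrow> 'a::field"
  assumes "finite I" "\<And>x. x \<notin> I \<Longrightarrow> f x = 0"
  shows "f = (\<Sum>i\<in>I. fun_scale (f i) (unit_vec i))"
proof
  fix x
  have "(\<Sum>i\<in>I. fun_scale (f i) (unit_vec i)) x = (\<Sum>i\<in>I. if x = i then f i else 0)"
    unfolding sum_fun_apply by (intro sum.cong) (auto simp: unit_vec_def)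
  also have "\<dots> = f x"
    using assms by simp
  finally show "f x = (\<Sum>i\<in>I. fun_scale (f i) (unit_vec i)) x" ..
qed

lemma span_unit_vec:
  assumes "finite I"
  shows "fun_space.span (unit_vec ` I) = {f :: 'b \<Rightarrow> 'a::field. \<forall>x. x \<notin> I \<longrightarrow> f x = 0}"
proof
  show "fun_space.span (unit_vec ` I) \<subseteq> {f :: 'b \<Rightarrow> 'a. \<forall>x. x \<notin> I \<longrightarrow> f x = 0}"
    by (rule fun_space.span_minimal) (auto simp: fun_space.subspace_def unit_vec_def)
  show "{f :: 'b \<Rightarrow> 'a. \<forall>x. x \<notin> I \<longrightarrow> f x = 0} \<subseteq> fun_space.span (unit_vec ` I)"
  proof
    fix f :: "'b \<Rightarrow> 'a" assume "f \<in> {f. \<forall>x. x \<notin> I \<longrightarrow> f x = 0}"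
    then have "f = (\<Sum>i\<in>I. fun_scale (f i) (unit_vec i))"
      using assms by (intro unit_vec_expansion) auto
    also have "\<dots> \<in> fun_space.span (unit_vec ` I)"
      by (intro fun_space.span_sum fun_space.span_scale fun_space.span_base) auto
    finally show "f \<in> fun_space.span (unit_vec ` I)" .
  qed
qed

lemma independent_unit_vec:
  assumes "finite I"
  shows "fun_space.independent (unit_vec ` I :: ('b \<Rightarrow> 'a::field) set)"
proof
  assume "fun_space.dependent (unit_vec ` I :: ('b \<Rightarrow> 'a) set)"
  then obtain i where "i \<in> I"
    "(unit_vec i :: 'b \<Rightarrow> 'a) \<in> fun_space.span (unit_vec ` I - {unit_vec i})"
    unfolding fun_space.dependent_def by blast
  moreover have "unit_vec ` I - {unit_vec i} = (unit_vec ` (I - {i}) :: ('b \<Rightarrow> 'a) set)"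
    by (simp add: image_set_diff[OF inj_unit_vec])
  ultimately have "(unit_vec i :: 'b \<Rightarrow> 'a) \<in> fun_space.span (unit_vec ` (I - {i}))"
    by simp
  then have "(unit_vec i :: 'b \<Rightarrow> 'a) i = 0"
    using assms by (simp add: span_unit_vec)
  then show False
    by (simp add: unit_vec_def)
qed

lemma coord_space_eq_span: "coord_space d = fun_space.span (unit_vec ` {..<d})"
  by (auto simp: span_unit_vec coord_space_def)

text \<open>Pick \<open>e\<close> outside \<open>A\<close>, extend a basis of \<open>A\<close> by
  \<open>e\<close>, and take the functional that is 1 at \<open>e\<close> and 0 on the basis. Its
  values at the unit vectors are the coefficients; not all of them vanish because the functional
  does not vanish at \<open>e\<close>.\<close>

lemma proper_subspace_annihilator:
  fixes A :: "('b \<Rightarrow> 'a::field) set"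
  assumes I: "finite I" and A: "fun_space.subspace A"
    and proper: "A \<subset> fun_space.span (unit_vec ` I)"
  obtains a i where "i \<in> I" "a i \<noteq> 0" "\<And>z. z \<in> A \<Longrightarrow> (\<Sum>i\<in>I. a i * z i) = 0"
proof -
  obtain e where e: "e \<in> fun_space.span (unit_vec ` I)" "e \<notin> A"
    using proper by blast
  obtain B where B: "B \<subseteq> A" "fun_space.independent B" "A \<subseteq> fun_space.span B"
    by (rule fun_space.maximal_independent_subset)
  have spanB: "fun_space.span B = A"
    using B A by (metis fun_space.span_subspace)
  then have "fun_space.independent (insert e B)"
    using e B by (simp add: fun_space.independent_insertI)
  then obtain \<phi> where \<phi>: "Vector_Spaces.linear fun_scale (*) \<phi>"
    "\<forall>x\<in>insert e B. \<phi> x = (if x = e then 1 else 0)"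
    using fun_dual.linear_independent_extend[where f = "\<lambda>x. if x = e then 1 else 0"] by blast
  have \<phi>_A: "\<phi> z = 0" if "z \<in> A" for z
  proof (rule fun_dual.linear_eq_0_on_span[OF \<phi>(1)])
    show "z \<in> fun_space.span B" using that spanB by simp
    show "\<phi> b = 0" if "b \<in> B" for b using that \<phi>(2) e B by auto
  qed
  have \<phi>_eq: "\<phi> z = (\<Sum>i\<in>I. \<phi> (unit_vec i) * z i)" if "z \<in> fun_space.span (unit_vec ` I)" for z
  proof -
    have "z = (\<Sum>i\<in>I. fun_scale (z i) (unit_vec i))"
      using that I by (intro unit_vec_expansion) (auto simp: span_unit_vec)
    then have "\<phi> z = \<phi> (\<Sum>i\<in>I. fun_scale (z i) (unit_vec i))"
      by (rule arg_cong)
    also have "\<dots> = (\<Sum>i\<in>I. \<phi> (unit_vec i) * z i)"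
      using \<phi>(1) by (simp add: fun_dual.linear_sum fun_dual.linear_scale mult.commute)
    finally show ?thesis .
  qed
  have "(\<Sum>i\<in>I. \<phi> (unit_vec i) * e i) \<noteq> 0"
    unfolding \<phi>_eq[OF e(1), symmetric] using \<phi>(2) by (metis insertI1 zero_neq_one)
  then obtain i where "i \<in> I" "\<phi> (unit_vec i) * e i \<noteq> 0"
    by (rule sum.not_neutral_contains_not_neutral)
  then have "i \<in> I" "\<phi> (unit_vec i) \<noteq> 0"
    by auto
  then show ?thesis
  proof (rule that[of i "\<lambda>i. \<phi> (unit_vec i)"])
    fix z assume "z \<in> A"
    then show "(\<Sum>i\<in>I. \<phi> (unit_vec i) * z i) = 0"
      using \<phi>_A[of z] \<phi>_eq[of z] proper by auto
  qed
qed

text \<open>Evaluation at the nodes \<open>y i\<close>, extended by zero outside \<open>I\<close>.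
  The case \<open>I = {..<d}\<close> is the map in \<open>g_haar_space\<close>; with
  \<open>y = id\<close> it restricts functions to a finite set of points.\<close>

definition sample :: "'i set \<Rightarrow> ('i \<Rightarrow> 'b) \<Rightarrow> ('b \<Rightarrow> 'a::field) \<Rightarrow> 'i \<Rightarrow> 'a" where
  "sample I y f = (\<lambda>i. if i \<in> I then f (y i) else 0)"

lemma linear_sample: "Vector_Spaces.linear fun_scale fun_scale (sample I y)"
  by (auto simp: Vector_Spaces.linear_iff fun_eq_iff sample_def fun_space.vector_space_axioms)

lemma sample_in_span: "finite I \<Longrightarrow> sample I y f \<in> fun_space.span (unit_vec ` I)"
  by (simp add: span_unit_vec sample_def)

lemma sample_eq_0_iff: "sample I y f = 0 \<longleftrightarrow> (\<forall>i\<in>I. f (y i) = 0)"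
  by (auto simp: sample_def fun_eq_iff)

lemma inj_on_sample_iff:
  "fun_space.subspace Y \<Longrightarrow>
    inj_on (sample I y) Y \<longleftrightarrow> (\<forall>f\<in>Y. (\<forall>i\<in>I. f (y i) = 0) \<longrightarrow> f = 0)"
  by (simp add: fun_pair.linear_inj_on_iff_eq_0[OF linear_sample] sample_eq_0_iff)

lemma sample_inj_iff_surj:
  fixes B :: "('b \<Rightarrow> 'a::field) set"
  assumes "fun_space.independent B" "finite B" "finite I" "card I = card B"
  shows "inj_on (sample I y) (fun_space.span B) \<longleftrightarrow>
    sample I y ` fun_space.span B = fun_space.span (unit_vec ` I)"
proof (rule fun_pair.inj_on_span_iff_surj[OF linear_sample assms(1,2)])
  show "fun_space.independent (unit_vec ` I :: ('c \<Rightarrow> 'a) set)"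
    using assms by (simp add: independent_unit_vec)
  show "card B = card (unit_vec ` I :: ('c \<Rightarrow> 'a) set)"
    using assms(4) by (simp add: card_unit_vec)
  show "sample I y ` B \<subseteq> fun_space.span (unit_vec ` I)"
    using assms(3) sample_in_span by blast
qed (use assms(3) in simp)

text \<open>Fewer evaluation conditions than the dimension leave a nontrivial kernel: an injective
  evaluation would carry \<open>B\<close> to too many independent vectors.\<close>

lemma exists_vanishing:
  fixes B :: "('b \<Rightarrow> 'a::field) set"
  assumes "fun_space.independent B" "finite B" "finite T" "card T < card B"
  obtains h where "h \<in> fun_space.span B" "h \<noteq> 0" "\<forall>t\<in>T. h t = 0"
proof -
  have "\<not> inj_on (sample T id) (fun_space.span B)"
  proof
    assume inj: "inj_on (sample T id) (fun_space.span B)"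
    have "fun_space.independent (sample T id ` B)"
      by (rule fun_pair.linear_independent_injective_image[OF linear_sample assms(1) inj])
    then have "card (sample T id ` B) \<le> card (unit_vec ` T :: ('b \<Rightarrow> 'a) set)"
      using fun_space.independent_span_bound[of "unit_vec ` T :: ('b \<Rightarrow> 'a) set"] assms(3)
        sample_in_span by blast
    also have "\<dots> \<le> card T"
      using assms(3) by (rule card_image_le)
    also have "\<dots> < card B" by fact
    also have "card B = card (sample T id ` B)"
      using inj_on_subset[OF inj fun_space.span_superset] by (simp add: card_image)
    finally show False by simp
  qed
  then show ?thesis
    using that by (auto simp: inj_on_sample_iff)
qed

section \<open>Continuous functions on a compact subset of the extended line\<close>

lemma sup_norm_le:
  "0 \<le> r \<Longrightarrow> (\<And>x. x \<in> X \<Longrightarrow> norm (f x) \<le> r) \<Longrightarrow> sup_norm X f \<le> r"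
  unfolding sup_norm_def by (rule cSup_least) auto

text \<open>Bolzano-Weierstrass, one point at a time; passing to a further subsequence keeps the
  limits already obtained.\<close>

lemma finite_pointwise_convergent_subsequence:
  fixes w :: "nat \<Rightarrow> 'b \<Rightarrow> 'a::heine_borel"
  assumes "finite T" "\<And>t. t \<in> T \<Longrightarrow> bounded (range (\<lambda>n. w n t))"
  shows "\<exists>r c. strict_mono r \<and> (\<forall>t\<in>T. (\<lambda>n. w (r n) t) \<longlonglongrightarrow> c t)"
  using assms
proof (induction T rule: finite_induct)
  case empty
  show ?case by (auto intro: strict_mono_id[unfolded id_def])
next
  case (insert s T)
  then obtain r c where r: "strict_mono r" "\<forall>t\<in>T. (\<lambda>n. w (r n) t) \<longlonglongrightarrow> c t"
    by auto
  have "bounded (range (\<lambda>n. w (r n) s))"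
    by (rule bounded_subset[OF insert.prems[of s]]) auto
  then obtain l r' where r': "strict_mono r'" "((\<lambda>n. w (r n) s) \<circ> r') \<longlonglongrightarrow> l"
    by (metis bounded_imp_convergent_subsequence)
  have "(\<lambda>n. w ((r \<circ> r') n) t) \<longlonglongrightarrow> (c(s := l)) t" if "t \<in> insert s T" for t
  proof (cases "t = s")
    case True
    then show ?thesis using r'(2) by (simp add: o_def)
  next
    case False
    then have "(\<lambda>n. w (r n) t) \<longlonglongrightarrow> c t"
      using that r(2) by auto
    from LIMSEQ_subseq_LIMSEQ[OF this r'(1)] False show ?thesis
      by (simp add: o_def)
  qed
  then show ?case
    using strict_mono_o[OF r(1) r'(1)] by blast
qed

text \<open>The pseudometric is pulled back from the real line along \<open>ext_fun g\<close>, so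
  \<open>ext_fun g\<close> preserves distances. It is the building block for interpolating functions
  later.\<close>

lemma continuous_map_ext_fun: "continuous_map (g_topology g) euclideanreal (ext_fun g)"
  unfolding continuous_map_def
proof (intro conjI allI impI)
  fix U :: "real set" assume "openin euclidean U"
  then have U: "open U" by simp
  show "openin (g_topology g) {x \<in> topspace (g_topology g). ext_fun g x \<in> U}"
    unfolding openin_g_topology topspace_g_topology
  proof (intro conjI ballI)
    fix x assume "x \<in> {x \<in> ext_line g. ext_fun g x \<in> U}"
    then obtain e where "e > 0" "ball (ext_fun g x) e \<subseteq> U"
      using U open_contains_ball by blast
    then show "\<exists>e>0. {y \<in> ext_line g. g_dist g x y < e} \<subseteq> {x \<in> ext_line g. ext_fun g x \<in> U}"
      by (intro exI[of _ e]) (auto simp: g_dist_def subset_iff dist_real_def)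
  qed auto
qed auto

locale compact_ext =
  fixes g :: "real \<Rightarrow> real" and X :: "ext_pt set"
  assumes compact_X: "compactin (g_topology g) X"
begin

abbreviation "X_top \<equiv> subtopology (g_topology g) X"

lemma X_subset: "X \<subseteq> ext_line g"
  using compactin_subset_topspace[OF compact_X] by simp

lemma topspace_X_top [simp]: "topspace X_top = X"
  using X_subset by auto

lemma compact_image:
  assumes "continuous_map X_top euclidean f"
  shows "compact (f ` X)"
proof -
  have "compactin X_top X"
    using compact_X by (simp add: compactin_subtopology)
  then show ?thesis
    using image_compactin[OF _ assms] by simp
qed

lemma in_C_g_iff:
  "f \<in> C_g g X \<longleftrightarrow> (\<forall>x\<in>X. (f \<longlongrightarrow> f x) (atin X_top x)) \<and> (\<forall>x. x \<notin> X \<longrightarrow> f x = 0)"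
  by (simp only: C_g_def mem_Collect_eq continuous_map_atin topspace_X_top limitin_canonical_iff)

lemma tendsto_C_g: "f \<in> C_g g X \<Longrightarrow> x \<in> X \<Longrightarrow> (f \<longlongrightarrow> f x) (atin X_top x)"
  by (simp add: in_C_g_iff)

lemma tendsto_ext_fun: "x \<in> X \<Longrightarrow> (ext_fun g \<longlongrightarrow> ext_fun g x) (atin X_top x)"
  using continuous_map_from_subtopology[OF continuous_map_ext_fun, of g X]
  by (simp only: continuous_map_atin topspace_X_top limitin_canonical_iff)

lemma C_g_outside: "f \<in> C_g g X \<Longrightarrow> x \<notin> X \<Longrightarrow> f x = 0"
  by (simp add: in_C_g_iff)

lemma C_g_diff: "f \<in> C_g g X \<Longrightarrow> h \<in> C_g g X \<Longrightarrow> f - h \<in> C_g g X"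
  unfolding in_C_g_iff fun_diff_def by (auto intro: tendsto_diff)

lemma C_g_scale:
  fixes f :: "ext_pt \<Rightarrow> 'a::real_normed_field"
  shows "f \<in> C_g g X \<Longrightarrow> fun_scale c f \<in> C_g g X"
  unfolding in_C_g_iff fun_scale_def by (auto intro: tendsto_mult)

text \<open>An open set contains, with each point, all points at pseudodistance zero, whereas
  distinct values in the field can be separated by an open set. Hence members of
  \<open>C_g g X\<close> depend only on the value of \<open>ext_fun g\<close>.\<close>

lemma C_g_factor:
  fixes f :: "ext_pt \<Rightarrow> 'a::real_normed_field"
  assumes f: "f \<in> C_g g X" and x: "x \<in> X" and y: "y \<in> X" and eq: "ext_fun g x = ext_fun g y"
  shows "f x = f y"
proof (rule ccontr)
  assume "f x \<noteq> f y"
  then obtain U where U: "open U" "f x \<in> U" "f y \<notin> U"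
    using t1_space by blast
  have "openin X_top {x \<in> X. f x \<in> U}"
    using f U(1) by (simp add: C_g_def continuous_map_def del: topspace_subtopology)
  then obtain W where W: "openin (g_topology g) W" "{x \<in> X. f x \<in> U} = W \<inter> X"
    by (auto simp: openin_subtopology)
  then have "x \<in> W" using x U by blast
  then obtain e where "e > 0" "{y \<in> ext_line g. g_dist g x y < e} \<subseteq> W"
    using W(1) openin_g_topology by meson
  moreover have "y \<in> ext_line g" "g_dist g x y = 0"
    using y X_subset eq by (auto simp: g_dist_def)
  ultimately have "y \<in> W"
    by auto
  then show False using W(2) y U by blast
qed

lemma compact_norm_image:
  assumes "f \<in> C_g g X"
  shows "compact ((\<lambda>x. norm (f x)) ` X)"
proof (rule compact_image)
  show "continuous_map X_top euclidean (\<lambda>x. norm (f x))"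
    unfolding continuous_map_atin topspace_X_top limitin_canonical_iff
    using assms by (auto intro: tendsto_norm tendsto_C_g)
qed

lemma bdd_above_sup_norm:
  assumes "f \<in> C_g g X"
  shows "bdd_above (insert 0 ((\<lambda>x. norm (f x)) ` X))"
  using compact_imp_bounded[OF compact_norm_image[OF assms]] by (simp add: bounded_imp_bdd_above)

lemma norm_le_sup_norm: "f \<in> C_g g X \<Longrightarrow> x \<in> X \<Longrightarrow> norm (f x) \<le> sup_norm X f"
  unfolding sup_norm_def by (rule cSup_upper[OF _ bdd_above_sup_norm]) auto

lemma sup_norm_nonneg: "f \<in> C_g g X \<Longrightarrow> 0 \<le> sup_norm X f"
  unfolding sup_norm_def by (rule cSup_upper[OF _ bdd_above_sup_norm]) auto

text \<open>The strict bound survives because the supremum is attained: compactness makes the set of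
  values closed. Positivity of \<open>r\<close> covers the inserted value 0.\<close>

lemma sup_norm_less:
  assumes f: "f \<in> C_g g X" and r: "0 < r" and less: "\<And>x. x \<in> X \<Longrightarrow> norm (f x) < r"
  shows "sup_norm X f < r"
proof -
  have "sup_norm X f \<in> insert 0 ((\<lambda>x. norm (f x)) ` X)"
    unfolding sup_norm_def
    using compact_imp_closed[OF compact_norm_image[OF f]] bdd_above_sup_norm[OF f]
    by (intro closed_contains_Sup) auto
  then show ?thesis using r less by auto
qed

section \<open>Unisolvence as a reformulation of the Haar property\<close>

definition unisolvent :: "(ext_pt \<Rightarrow> 'a::real_normed_field) set \<Rightarrow> nat \<Rightarrow> bool" where
  "unisolvent Y d \<longleftrightarrow> (\<forall>T\<subseteq>X. finite T \<and> card T = d \<and> inj_on (ext_fun g) T \<longrightarrow>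
     (\<forall>f\<in>Y. (\<forall>t\<in>T. f t = 0) \<longrightarrow> f = 0))"

text \<open>Evaluation is linear, and with as many nodes as the dimension injectivity already gives
  surjectivity, so only the kernel condition remains. Indexed nodes are traded for finite sets by
  enumerating them.\<close>

lemma g_haar_space_iff_unisolvent:
  fixes B :: "(ext_pt \<Rightarrow> 'a::real_normed_field) set"
  assumes B: "fun_space.independent B" "finite B" and sub: "fun_space.span B \<subseteq> C_g g X"
  shows "g_haar_space g X (fun_space.span B) \<longleftrightarrow> unisolvent (fun_space.span B) (card B)"
proof -
  let ?Y = "fun_space.span B" and ?d = "card B"
  have iso: "fun_space_iso ?Y (coord_space ?d) (\<lambda>f i. if i < ?d then f (y i) else 0) \<longleftrightarrow>
      (\<forall>f\<in>?Y. (\<forall>i<?d. f (y i) = 0) \<longrightarrow> f = 0)" for y :: "nat \<Rightarrow> ext_pt"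
  proof -
    have eq: "(\<lambda>f i. if i < ?d then f (y i) else 0) = (sample {..<?d} y :: (ext_pt \<Rightarrow> 'a) \<Rightarrow> nat \<Rightarrow> 'a)"
      by (simp add: sample_def fun_eq_iff)
    have "fun_space_iso ?Y (coord_space ?d) (sample {..<?d} y) \<longleftrightarrow> inj_on (sample {..<?d} y) ?Y"
      using linear_sample[of "{..<?d}" y] sample_inj_iff_surj[OF B, of "{..<?d}" y]
      by (auto simp: fun_space_iso_def bij_betw_def coord_space_eq_span Vector_Spaces.linear_iff)
    then show ?thesis
      unfolding eq by (simp add: inj_on_sample_iff Ball_def)
  qed
  have dim: "fun_space.dim ?Y = ?d"
    using B by (simp add: fun_space.dim_eq_card_independent)
  have "g_haar_space g X ?Y \<longleftrightarrow> (\<forall>y. (\<forall>i<?d. y i \<in> X) \<and>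
      (\<forall>i<?d. \<forall>j<?d. i \<noteq> j \<longrightarrow> g_distinct g (y i) (y j)) \<longrightarrow>
      (\<forall>f\<in>?Y. (\<forall>i<?d. f (y i) = 0) \<longrightarrow> f = 0))"
    unfolding g_haar_space_def Let_def dim iso
    using B sub by (auto simp: finite_dim_def)
  also have "\<dots> \<longleftrightarrow> unisolvent ?Y ?d"
  proof
    assume L: "\<forall>y. (\<forall>i<?d. y i \<in> X) \<and>
      (\<forall>i<?d. \<forall>j<?d. i \<noteq> j \<longrightarrow> g_distinct g (y i) (y j)) \<longrightarrow>
      (\<forall>f\<in>?Y. (\<forall>i<?d. f (y i) = 0) \<longrightarrow> f = 0)"
    show "unisolvent ?Y ?d"
      unfolding unisolvent_def
    proof (intro allI impI ballI)
      fix T f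
      assume T: "T \<subseteq> X" "finite T \<and> card T = ?d \<and> inj_on (ext_fun g) T"
        and f: "f \<in> ?Y" "\<forall>t\<in>T. f t = 0"
      obtain y where y: "bij_betw y {0..<?d} T"
        using ex_bij_betw_nat_finite[of T] T by auto
      have y_in: "y i \<in> T" if "i < ?d" for i
        using bij_betwE[OF y] that by simp
      have "g_distinct g (y i) (y j)" if ij: "i < ?d" "j < ?d" "i \<noteq> j" for i j
      proof -
        have "y i \<noteq> y j"
          using inj_onD[OF bij_betw_imp_inj_on[OF y], of i j] ij by auto
        then show ?thesis
          using T(2) y_in[OF ij(1)] y_in[OF ij(2)] unfolding g_distinct_def by (meson inj_onD)
      qed
      moreover have "\<forall>i<?d. y i \<in> X" "\<forall>i<?d. f (y i) = 0"
        using y_in T(1) f(2) by blast+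
      ultimately show "f = 0"
        using L f(1) by blast
    qed
  next
    assume R: "unisolvent ?Y ?d"
    show "\<forall>y. (\<forall>i<?d. y i \<in> X) \<and>
      (\<forall>i<?d. \<forall>j<?d. i \<noteq> j \<longrightarrow> g_distinct g (y i) (y j)) \<longrightarrow>
      (\<forall>f\<in>?Y. (\<forall>i<?d. f (y i) = 0) \<longrightarrow> f = 0)"
    proof (intro allI impI ballI, elim conjE)
      fix y f
      assume y: "\<forall>i<?d. y i \<in> X" "\<forall>i<?d. \<forall>j<?d. i \<noteq> j \<longrightarrow> g_distinct g (y i) (y j)"
        and f: "f \<in> ?Y" "\<forall>i<?d. f (y i) = 0"
      have "inj_on (ext_fun g \<circ> y) {..<?d}"
        using y(2) by (auto simp: inj_on_def g_distinct_def)
      then have "inj_on y {..<?d}" "inj_on (ext_fun g) (y ` {..<?d})"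
        by (auto dest: inj_on_imageI inj_on_imageI2)
      moreover from this have "card (y ` {..<?d}) = ?d"
        by (simp add: card_image)
      moreover have "y ` {..<?d} \<subseteq> X"
        using y(1) by auto
      ultimately show "f = 0"
        using R f unfolding unisolvent_def by blast
    qed
  qed
  finally show ?thesis .
qed

lemma unisolvent_interpolate:
  assumes B: "fun_space.independent B" "finite B" and uni: "unisolvent (fun_space.span B) (card B)"
    and T: "T \<subseteq> X" "finite T" "card T = card B" "inj_on (ext_fun g) T"
  obtains f where "f \<in> fun_space.span B" "\<And>t. t \<in> T \<Longrightarrow> f t = c t"
proof -
  have "inj_on (sample T id) (fun_space.span B)"
    using uni T unfolding inj_on_sample_iff[OF fun_space.subspace_span] unisolvent_def by auto
  then have "sample T id ` fun_space.span B = fun_space.span (unit_vec ` T)"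
    using sample_inj_iff_surj[OF B T(2,3)] by blast
  then have "sample T id c \<in> sample T id ` fun_space.span B"
    using sample_in_span[OF T(2)] by blast
  then obtain f where "f \<in> fun_space.span B" "sample T id f = sample T id c"
    by (metis imageE)
  then show ?thesis
    using that by (metis id_apply sample_def)
qed

text \<open>As long as nodes are missing, some nonzero \<open>h\<close> in the span vanishes at all
  present ones. A point where \<open>h\<close> is nonzero lies in \<open>X\<close> and, by
  \<open>C_g_factor\<close>, is \<open>g\<close>-distinct from every present node, so it can be
  added.\<close>

lemma extend_nodes:
  fixes B :: "(ext_pt \<Rightarrow> 'a::real_normed_field) set"
  assumes B: "fun_space.independent B" "finite B" and sub: "fun_space.span B \<subseteq> C_g g X"
    and S: "S \<subseteq> X" "finite S" "inj_on (ext_fun g) S" "card S \<le> card B"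
  shows "\<exists>T. S \<subseteq> T \<and> T \<subseteq> X \<and> finite T \<and> inj_on (ext_fun g) T \<and> card T = card B"
  using S
proof (induction "card B - card S" arbitrary: S)
  case 0
  then show ?case by (intro exI[of _ S]) auto
next
  case (Suc n)
  have "card S < card B"
    using Suc.hyps(2) by linarith
  then obtain h where h: "h \<in> fun_space.span B" "h \<noteq> 0" "\<forall>t\<in>S. h t = 0"
    by (rule exists_vanishing[OF B Suc.prems(2)])
  then obtain x where x: "h x \<noteq> 0"
    by (auto simp: fun_eq_iff)
  have hC: "h \<in> C_g g X" using h sub by auto
  then have "x \<in> X" using x C_g_outside by blast
  moreover have "ext_fun g x \<noteq> ext_fun g t" if "t \<in> S" for t
    using C_g_factor[OF hC \<open>x \<in> X\<close>, of t] that h(3) x Suc.prems(1) by auto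
  ultimately have "insert x S \<subseteq> X" "inj_on (ext_fun g) (insert x S)" "x \<notin> S"
    using Suc.prems by auto
  then have "\<exists>T. insert x S \<subseteq> T \<and> T \<subseteq> X \<and> finite T \<and> inj_on (ext_fun g) T \<and> card T = card B"
    using Suc.hyps(2) Suc.prems by (intro Suc.hyps(1)) auto
  then show ?case by blast
qed

section \<open>Best approximation\<close>

text \<open>One direction of Kolmogorov's criterion: where \<open>|e|\<close> is maximal,
  \<open>q\<close> has positive real inner product with \<open>e\<close>, so a small step along
  \<open>q\<close> lowers the error there, while elsewhere there is slack.\<close>

lemma sup_norm_perturb_less:
  fixes e q :: "ext_pt \<Rightarrow> 'a::{real_normed_field,real_inner}"
  assumes e: "e \<in> C_g g X" and q: "q \<in> C_g g X" and m: "0 < m"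
    and le: "\<And>x. x \<in> X \<Longrightarrow> norm (e x) \<le> m"
    and eq: "\<And>x. x \<in> X \<Longrightarrow> norm (e x) = m \<Longrightarrow> q x = e x"
  shows "\<exists>t. sup_norm X (e - fun_scale (of_real t) q) < m"
proof -
  \<comment> \<open>\<open>\<psi>\<close> is positive on \<open>X\<close>, so \<open>X\<close> splits uniformly into points where the step along \<open>q\<close>
    decreases \<open>|e|\<close> to first order and points where \<open>|e|\<close> stays away from \<open>m\<close>.\<close>
  define \<psi> where "\<psi> x = max (e x \<bullet> q x) (m\<^sup>2 - (norm (e x))\<^sup>2)" for x
  have "continuous_map X_top euclideanreal \<psi>"
    unfolding continuous_map_atin topspace_X_top limitin_canonical_iff \<psi>_def
    by (auto intro!: tendsto_intros tendsto_max tendsto_C_g[OF e] tendsto_C_g[OF q])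
  then have compact: "compact (\<psi> ` X)"
    by (rule compact_image)
  have pos: "0 < \<psi> x" if "x \<in> X" for x
  proof (cases "norm (e x) = m")
    case True
    then have "e x \<bullet> q x = m\<^sup>2"
      using eq[OF that] by (simp add: dot_square_norm)
    then show ?thesis using m by (simp add: \<psi>_def)
  next
    case False
    then have "norm (e x) < m"
      using le[OF that] by simp
    then have "(norm (e x))\<^sup>2 < m\<^sup>2"
      by (simp add: power_strict_mono)
    then show ?thesis by (simp add: \<psi>_def)
  qed
  have "\<exists>\<eta>>0. \<forall>x\<in>X. \<eta> \<le> \<psi> x"
  proof (cases "X = {}")
    case True
    then show ?thesis by (auto intro: exI[of _ 1])
  next
    case False
    then obtain x where "x \<in> X" "\<forall>y\<in>X. \<psi> x \<le> \<psi> y"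
      using compact_attains_inf[OF compact] by auto
    then show ?thesis using pos by blast
  qed
  then obtain \<eta> where \<eta>: "0 < \<eta>" "\<And>x. x \<in> X \<Longrightarrow> \<eta> \<le> \<psi> x"
    by blast
  define M where "M = sup_norm X q"
  have M: "0 \<le> M" "\<And>x. x \<in> X \<Longrightarrow> norm (q x) \<le> M"
    unfolding M_def using q sup_norm_nonneg norm_le_sup_norm by auto
  \<comment> \<open>For \<open>t \<le> 1\<close>, the product \<open>t * K\<close> bounds the
    largest possible growth of \<open>|e|\<close> squared under a step of length
    \<open>t\<close>.\<close>
  define K where "K = 2 * m * M + M\<^sup>2"
  have K: "0 \<le> K" using M(1) m by (simp add: K_def)
  \<comment> \<open>The bound 1 gives \<open>t * t \<le> t\<close>; the denominator
    \<open>K + 1\<close> is positive even for \<open>K = 0\<close> and makes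
    \<open>t * K < \<eta>\<close> strict.\<close>
  define t where "t = min 1 (\<eta> / (K + 1))"
  have t: "0 < t" "t \<le> 1"
    using \<eta>(1) K by (auto simp: t_def)
  have "t * K < t * (K + 1)"
    using t(1) by simp
  also have "\<dots> \<le> \<eta> / (K + 1) * (K + 1)"
    using K by (intro mult_right_mono) (auto simp: t_def)
  also have "\<dots> = \<eta>"
    using K by simp
  finally have tK: "t * K < \<eta>" .
  have "sup_norm X (e - fun_scale (of_real t) q) < m"
  proof (rule sup_norm_less[OF C_g_diff[OF e C_g_scale[OF q]] m])
    fix x assume x: "x \<in> X"
    have sq: "(norm (e x - t *\<^sub>R q x))\<^sup>2 = (norm (e x))\<^sup>2 - 2 * t * (e x \<bullet> q x) + t\<^sup>2 * (norm (q x))\<^sup>2"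
      by (simp add: power2_norm_eq_inner inner_diff_left inner_diff_right inner_commute)
        (simp add: algebra_simps power2_eq_square)
    have quad: "t\<^sup>2 * (norm (q x))\<^sup>2 \<le> t * (t * M\<^sup>2)"
      using M(2)[OF x] t(1) by (simp add: power2_eq_square[of t] mult.assoc mult_left_mono power_mono)
    have tM: "t * M\<^sup>2 \<le> t * K"
      using M(1) m t(1) by (intro mult_left_mono) (auto simp: K_def)
    have "(norm (e x - t *\<^sub>R q x))\<^sup>2 < m\<^sup>2"
    \<comment> \<open>If the inner product is at least \<eta>, the linear gain
      \<open>2 * t * \<eta>\<close> beats the quadratic term, which is below
      \<open>t * \<eta>\<close>. Otherwise \<psi> provides slack \<eta> in \<open>|e|\<close>
      squared, more than the growth \<open>t * K\<close>.\<close>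
    proof (cases "\<eta> \<le> e x \<bullet> q x")
      case True
      have "(norm (e x))\<^sup>2 \<le> m\<^sup>2"
        using le[OF x] by (simp add: power_mono)
      moreover have "t * \<eta> \<le> t * (e x \<bullet> q x)"
        using True t by simp
      moreover have "t * (t * M\<^sup>2) < t * \<eta>"
        using le_less_trans[OF tM tK] t(1) by (rule mult_strict_left_mono)
      moreover have "0 < t * \<eta>"
        using t(1) \<eta>(1) by simp
      ultimately show ?thesis
        using sq quad by simp
    next
      case False
      then have "(norm (e x))\<^sup>2 \<le> m\<^sup>2 - \<eta>"
        using \<eta>(2)[OF x] by (auto simp: \<psi>_def)
      moreover have "- (e x \<bullet> q x) \<le> m * M"
      proof -
        have "- (e x \<bullet> q x) \<le> norm (e x) * norm (q x)"
          using Cauchy_Schwarz_ineq2[of "e x" "q x"] by linarith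
        also have "\<dots> \<le> m * M"
          using le[OF x] M(2)[OF x] m by (intro mult_mono) auto
        finally show ?thesis .
      qed
      then have "t * (- (e x \<bullet> q x)) \<le> t * (m * M)"
        using t by (intro mult_left_mono) auto
      moreover have "t * (t * M\<^sup>2) \<le> 1 * (t * M\<^sup>2)"
        using t by (intro mult_right_mono) auto
      ultimately show ?thesis
        using sq quad tK by (simp add: K_def algebra_simps)
    qed
    then have "norm (e x - t *\<^sub>R q x) < m"
      using m by (simp add: power2_less_imp_less)
    then show "norm ((e - fun_scale (of_real t) q) x) < m"
      by (simp add: scaleR_conv_of_real)
  qed
  then show ?thesis ..
qed

lemma best_approx_exists:
  fixes B :: "(ext_pt \<Rightarrow> 'a::{real_normed_field,heine_borel}) set"
  assumes B: "fun_space.independent B" "finite B" and sub: "fun_space.span B \<subseteq> C_g g X"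
    and uni: "unisolvent (fun_space.span B) (card B)"
    and v: "v \<in> C_g g X" and m: "m = (INF w\<in>fun_space.span B. sup_norm X (v - w))"
  obtains y where "y \<in> fun_space.span B" "sup_norm X (v - y) \<le> m"
proof -
  let ?Y = "fun_space.span B"
  have bdd: "bdd_below ((\<lambda>w. sup_norm X (v - w)) ` ?Y)"
    using sub v by (intro bdd_belowI[of _ 0]) (auto intro!: sup_norm_nonneg C_g_diff)
  have nonempty: "?Y \<noteq> {}"
    using fun_space.span_zero by blast
  \<comment> \<open>A minimizing sequence with errors tending to the infimum
    \<open>m\<close>.\<close>
  have "\<exists>w\<in>?Y. sup_norm X (v - w) < m + inverse (real (Suc n))" for n
    using cINF_less_iff[OF nonempty bdd, of "m + inverse (real (Suc n))"] m by simp
  then obtain w where w: "\<And>n. w n \<in> ?Y" "\<And>n. sup_norm X (v - w n) < m + inverse (real (Suc n))"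
    by metis
  have close: "norm (v x - w n x) \<le> m + inverse (real (Suc n))" if "x \<in> X" for x n
    using norm_le_sup_norm[OF C_g_diff[OF v subsetD[OF sub w(1)[of n]]] that] w(2)[of n] by simp
  obtain T where T: "T \<subseteq> X" "finite T" "inj_on (ext_fun g) T" "card T = card B"
    using extend_nodes[OF B sub, of "{}"] by auto
  have "bounded (range (\<lambda>n. w n t))" if "t \<in> T" for t
  proof (rule boundedI)
    fix z assume "z \<in> range (\<lambda>n. w n t)"
    then obtain n where z: "z = w n t" by blast
    have "norm (w n t) \<le> norm (v t) + norm (v t - w n t)"
      using norm_triangle_ineq4[of "v t" "v t - w n t"] by simp
    also have "norm (v t - w n t) \<le> m + inverse (real (Suc n))"
      using close T(1) that by blast
    also have "inverse (real (Suc n)) \<le> 1"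
      by (simp add: inverse_le_1_iff)
    finally show "norm z \<le> norm (v t) + (m + 1)"
      using z by simp
  qed
  then obtain r c where r: "strict_mono r" "\<forall>t\<in>T. (\<lambda>n. w (r n) t) \<longlonglongrightarrow> c t"
    using finite_pointwise_convergent_subsequence[OF T(2), of w] by blast
  \<comment> \<open>Lagrange basis for the nodes: \<open>L t\<close> is 1 at \<open>t\<close> and 0
    at the other nodes.\<close>
  have "\<exists>L\<in>?Y. \<forall>s\<in>T. L s = unit_vec t s" for t
    using unisolvent_interpolate[OF B uni T(1,2,4,3)] by metis
  then obtain L where L: "\<And>t. L t \<in> ?Y" "\<And>t s. s \<in> T \<Longrightarrow> L t s = unit_vec t s"
    by metis
  \<comment> \<open>The difference of both sides lies in the span and vanishes at all nodes, hence
    is zero by unisolvence.\<close>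
  have lagrange: "u x = (\<Sum>t\<in>T. u t * L t x)" if u: "u \<in> ?Y" for u x
  proof -
    define d where "d = u - (\<Sum>t\<in>T. fun_scale (u t) (L t))"
    have "d \<in> ?Y"
      unfolding d_def
      using u L(1) by (intro fun_space.span_diff fun_space.span_sum fun_space.span_scale) auto
    moreover have "d s = 0" if "s \<in> T" for s
    proof -
      have "(\<Sum>t\<in>T. u t * L t s) = (\<Sum>t\<in>T. if s = t then u t else 0)"
        using that L(2) by (intro sum.cong) (auto simp: unit_vec_def)
      then show ?thesis
        using that T(2) by (simp add: d_def sum_fun_apply)
    qed
    ultimately have "d = 0"
      using uni T unfolding unisolvent_def by blast
    then have "d x = 0" by simp
    then show ?thesis by (simp add: d_def sum_fun_apply)
  qed
  define y where "y = (\<Sum>t\<in>T. fun_scale (c t) (L t))"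
  have y: "y \<in> ?Y"
    unfolding y_def using L(1) by (intro fun_space.span_sum fun_space.span_scale) auto
  have lim: "(\<lambda>n. w (r n) x) \<longlonglongrightarrow> y x" for x
  proof -
    have "(\<lambda>n. \<Sum>t\<in>T. w (r n) t * L t x) \<longlonglongrightarrow> (\<Sum>t\<in>T. c t * L t x)"
      using r(2) by (intro tendsto_sum tendsto_mult tendsto_const) auto
    moreover have "(\<lambda>n. w (r n) x) = (\<lambda>n. \<Sum>t\<in>T. w (r n) t * L t x)"
      using lagrange[OF w(1)] by blast
    ultimately show ?thesis
      by (simp add: y_def sum_fun_apply)
  qed
  have "(\<lambda>n. m + inverse (real (Suc n))) \<longlonglongrightarrow> m"
    by (rule LIMSEQ_inverse_real_of_nat_add)
  then have m_lim: "(\<lambda>n. m + inverse (real (Suc (r n)))) \<longlonglongrightarrow> m"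
    using LIMSEQ_subseq_LIMSEQ[OF _ r(1)] by (fastforce simp: o_def)
  have "sup_norm X (v - y) \<le> m"
  \<comment> \<open>Pointwise convergence suffices: the error bound at each fixed point of
    \<open>X\<close> passes to the limit.\<close>
  proof (rule sup_norm_le)
    show "0 \<le> m"
      unfolding m using nonempty sub v
      by (intro cINF_greatest) (auto intro!: sup_norm_nonneg C_g_diff)
    fix x assume "x \<in> X"
    have "(\<lambda>n. norm (v x - w (r n) x)) \<longlonglongrightarrow> norm (v x - y x)"
      by (intro tendsto_intros lim)
    then have "norm (v x - y x) \<le> m"
      by (rule LIMSEQ_le[OF _ m_lim]) (use close \<open>x \<in> X\<close> in blast)
    then show "norm ((v - y) x) \<le> m" by simp
  qed
  with y show ?thesis by (rule that)
qed

lemma best_approx_unique: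
  fixes B :: "(ext_pt \<Rightarrow> 'a::{real_normed_field,real_inner}) set"
  assumes B: "fun_space.independent B" "finite B" and sub: "fun_space.span B \<subseteq> C_g g X"
    and uni: "unisolvent (fun_space.span B) (card B)"
    and v: "v \<in> C_g g X" and lower: "\<And>w. w \<in> fun_space.span B \<Longrightarrow> m \<le> sup_norm X (v - w)"
    and y: "y \<in> fun_space.span B" "sup_norm X (v - y) \<le> m"
    and z: "z \<in> fun_space.span B" "sup_norm X (v - z) \<le> m"
  shows "y = z"
proof -
  let ?Y = "fun_space.span B"
  have y_le: "norm (v x - y x) \<le> m" if "x \<in> X" for x
    using norm_le_sup_norm[OF C_g_diff[OF v subsetD[OF sub y(1)]] that] y(2) by simp
  have z_le: "norm (v x - z x) \<le> m" if "x \<in> X" for x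
    using norm_le_sup_norm[OF C_g_diff[OF v subsetD[OF sub z(1)]] that] z(2) by simp
  have "0 \<le> m"
    using sup_norm_nonneg[OF C_g_diff[OF v subsetD[OF sub y(1)]]] y(2) by simp
  show ?thesis
  \<comment> \<open>With error 0, both approximations equal \<open>v\<close> on \<open>X\<close> and
    vanish outside. The perturbation argument covers positive \<open>m\<close>.\<close>
  proof (cases "m = 0")
    case True
    have "y x = z x" for x
      using y_le[of x] z_le[of x] True C_g_outside[OF subsetD[OF sub y(1)]]
        C_g_outside[OF subsetD[OF sub z(1)]] by (cases "x \<in> X") auto
    then show ?thesis by blast
  next
    case False
    then have m: "0 < m" using \<open>0 \<le> m\<close> by simp
    define p where "p = fun_scale (1/2) (y + z)"
    have p: "p \<in> ?Y"
      unfolding p_def using y z by (intro fun_space.span_scale fun_space.span_add)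
    have mid: "v x - p x = ((v x - y x) + (v x - z x)) / 2" for x
      by (simp add: p_def field_simps)
    have p_le: "norm (v x - p x) \<le> m" if "x \<in> X" for x
      using norm_triangle_ineq[of "v x - y x" "v x - z x"] y_le[OF that] z_le[OF that]
      unfolding mid by (simp add: norm_divide)
    define E where "E = {x \<in> X. norm (v x - p x) = m}"
    have "E \<subseteq> X" by (auto simp: E_def)
    \<comment> \<open>Strict convexity through the parallelogram law: two errors of norm at most
      \<open>m\<close> whose sum has norm \<open>2 * m\<close> must coincide.\<close>
    have agree: "y x = z x" if "x \<in> E" for x
    proof -
      let ?a = "v x - y x" and ?b = "v x - z x"
      have x: "x \<in> X" "norm (?a + ?b) = 2 * m"
        using that unfolding E_def mid by (auto simp: norm_divide)
      have "(norm (?a + ?b))\<^sup>2 + (norm (?a - ?b))\<^sup>2 = 2 * (norm ?a)\<^sup>2 + 2 * (norm ?b)\<^sup>2"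
        by (simp only: power2_norm_eq_inner inner_diff_left inner_diff_right inner_add_left
          inner_add_right inner_commute) (simp add: algebra_simps)
      moreover have "(norm ?a)\<^sup>2 \<le> m\<^sup>2" "(norm ?b)\<^sup>2 \<le> m\<^sup>2"
        using y_le[OF x(1)] z_le[OF x(1)] by (simp_all add: power_mono)
      moreover have "(norm (?a + ?b))\<^sup>2 = 4 * m\<^sup>2"
        unfolding x(2) by (simp add: power_mult_distrib)
      ultimately have "(norm (?a - ?b))\<^sup>2 \<le> 0"
        by linarith
      then show ?thesis by simp
    qed
    show ?thesis
    \<comment> \<open>What counts is the number of values of \<open>ext_fun g\<close> on
      \<open>E\<close>, not of points: even an infinite \<open>E\<close> may carry few
      \<open>g\<close>-distinct nodes.\<close>
    proof (cases "finite (ext_fun g ` E) \<and> card (ext_fun g ` E) < card B")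
      case True
      \<comment> \<open>One representative per value. Interpolating \<open>v - p\<close> at these
        representatives matches it on all of \<open>E\<close> by \<open>C_g_factor\<close>.\<close>
      obtain S where S: "S \<subseteq> E" "inj_on (ext_fun g) S" "ext_fun g ` E = ext_fun g ` S"
        using subset_image_inj[of "ext_fun g ` E" "ext_fun g" E] by auto
      have fin: "finite S" "card S < card B"
        using True S(3) finite_image_iff[OF S(2)] card_image[OF S(2)] by auto
      have "S \<subseteq> X" using S(1) \<open>E \<subseteq> X\<close> by blast
      then obtain T where T: "S \<subseteq> T" "T \<subseteq> X" "finite T" "inj_on (ext_fun g) T" "card T = card B"
        using extend_nodes[OF B sub _ fin(1) S(2)] fin(2) by auto
      obtain q where q: "q \<in> ?Y" "\<And>t. t \<in> T \<Longrightarrow> q t = (v - p) t"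
        using unisolvent_interpolate[OF B uni T(2,3,5,4), of "v - p"] by blast
      have vp: "v - p \<in> C_g g X" and qC: "q \<in> C_g g X"
        using v p q(1) sub C_g_diff by auto
      have "q x = (v - p) x" if "x \<in> E" for x
      proof -
        have "ext_fun g x \<in> ext_fun g ` S"
          unfolding S(3)[symmetric] using that by (rule imageI)
        then obtain s where s: "s \<in> S" "ext_fun g x = ext_fun g s"
          by (auto elim: imageE)
        have X: "x \<in> X" "s \<in> X"
          using that s(1) \<open>E \<subseteq> X\<close> \<open>S \<subseteq> X\<close> by blast+
        have "q x = q s"
          by (rule C_g_factor[OF qC X s(2)])
        also have "\<dots> = (v - p) s"
          using q(2) s(1) T(1) by blast
        also have "\<dots> = (v - p) x"
          by (rule C_g_factor[OF vp X s(2), symmetric])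
        finally show ?thesis .
      qed
      then obtain t where "sup_norm X ((v - p) - fun_scale (of_real t) q) < m"
        using sup_norm_perturb_less[OF vp qC m] p_le by (auto simp: E_def)
      \<comment> \<open>The perturbed \<open>p\<close> stays in the span, so its smaller error
        contradicts the lower bound \<open>m\<close>.\<close>
      moreover have "m \<le> sup_norm X (v - (p + fun_scale (of_real t) q))"
        using p q(1) by (intro lower fun_space.span_add fun_space.span_scale)
      ultimately show ?thesis by (simp add: diff_diff_add)
    next
      case False
      then obtain S where S: "S \<subseteq> ext_fun g ` E" "finite S" "card S = card B"
        by (metis infinite_arbitrarily_large obtain_subset_with_card_n not_less)
      then obtain T where T: "T \<subseteq> E" "inj_on (ext_fun g) T" "S = ext_fun g ` T"
        using subset_image_inj by metis
      have "finite T" "card T = card B"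
        using S T(3) finite_image_iff[OF T(2)] card_image[OF T(2)] by auto
      moreover have "T \<subseteq> X" using T(1) \<open>E \<subseteq> X\<close> by blast
      moreover have "y - z \<in> ?Y" using y z by (intro fun_space.span_diff)
      moreover have "\<forall>t\<in>T. (y - z) t = 0" using agree T(1) by auto
      ultimately have "y - z = 0"
        using uni T(2) unfolding unisolvent_def by blast
      then show ?thesis by simp
    qed
  qed
qed

text \<open>The class \<open>euclidean_space\<close> supplies both ingredients: bounded sequences
  have convergent subsequences, for existence, and the norm comes from an inner product, for
  uniqueness. Both \<open>real\<close> and \<open>complex\<close> are instances.\<close>

lemma unisolvent_imp_chebyshev:
  fixes B :: "(ext_pt \<Rightarrow> 'a::{real_normed_field,euclidean_space}) set"
  assumes B: "fun_space.independent B" "finite B" and sub: "fun_space.span B \<subseteq> C_g g X"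
    and uni: "unisolvent (fun_space.span B) (card B)"
  shows "chebyshev_space (C_g g X) (sup_norm X) (fun_space.span B)"
  unfolding chebyshev_space_def
proof (intro conjI ballI sub fun_space.subspace_span)
  let ?Y = "fun_space.span B"
  fix v :: "ext_pt \<Rightarrow> 'a" assume v: "v \<in> C_g g X"
  define m where "m = (INF w\<in>?Y. sup_norm X (v - w))"
  have bdd: "bdd_below ((\<lambda>w. sup_norm X (v - w)) ` ?Y)"
    using sub v by (intro bdd_belowI[of _ 0]) (auto intro!: sup_norm_nonneg C_g_diff)
  have lower: "m \<le> sup_norm X (v - w)" if "w \<in> ?Y" for w
    unfolding m_def using bdd that by (rule cINF_lower)
  obtain y where y: "y \<in> ?Y" "sup_norm X (v - y) \<le> m"
    using best_approx_exists[OF B sub uni v m_def] by blast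
  show "\<exists>!y. y \<in> ?Y \<and> sup_norm X (v - y) = (INF w\<in>?Y. sup_norm X (v - w))"
    unfolding m_def[symmetric]
  proof (rule ex1I[of _ y])
    show "y \<in> ?Y \<and> sup_norm X (v - y) = m"
      using y lower[OF y(1)] by simp
    show "z = y" if "z \<in> ?Y \<and> sup_norm X (v - z) = m" for z
      using best_approx_unique[OF B sub uni v lower, of z y] that y by simp
  qed
qed

section \<open>Failure of uniqueness without the Haar property\<close>

lemma exists_bounded_interpolant:
  fixes s :: "ext_pt \<Rightarrow> 'a::real_normed_field"
  assumes T: "T \<subseteq> X" "finite T" "inj_on (ext_fun g) T" and s: "\<And>t. t \<in> T \<Longrightarrow> norm (s t) \<le> 1"
  obtains u where "u \<in> C_g g X" "\<And>x. norm (u x) \<le> 1" "\<And>t. t \<in> T \<Longrightarrow> u t = s t"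
proof -
  \<comment> \<open>Lagrange polynomials in the variable \<open>ext_fun g x\<close>; the
    denominators are nonzero because the nodes are \<open>g\<close>-distinct.\<close>
  define l where "l t x = (\<Prod>r\<in>T - {t}. (ext_fun g x - ext_fun g r) / (ext_fun g t - ext_fun g r))"
    for t x
  define w where "w x = (\<Sum>t\<in>T. s t * of_real (l t x))" for x
  \<comment> \<open>Radial retraction onto the closed unit ball. It fixes the prescribed values,
    whose norm is at most 1.\<close>
  define u where "u x = (if x \<in> X then w x / of_real (max 1 (norm (w x))) else 0)" for x
  have l: "l t x = (if x = t then 1 else 0)" if "t \<in> T" "x \<in> T" for t x
  proof (cases "x = t")
    case True
    have "(ext_fun g t - ext_fun g r) / (ext_fun g t - ext_fun g r) = 1" if "r \<in> T - {t}" for r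
      using inj_onD[OF T(3), of t r] that \<open>t \<in> T\<close> by auto
    then show ?thesis using True by (simp add: l_def)
  next
    case False
    then show ?thesis using that T(2) by (auto simp: l_def)
  qed
  have w: "w x = s x" if "x \<in> T" for x
  proof -
    have "w x = (\<Sum>t\<in>T. if x = t then s t else 0)"
      unfolding w_def using that by (intro sum.cong) (auto simp: l)
    then show ?thesis using that T(2) by simp
  qed
  have cont: "(w \<longlongrightarrow> w x) (atin X_top x)" if "x \<in> X" for x
    unfolding w_def l_def divide_inverse
    using that by (intro tendsto_sum tendsto_mult tendsto_of_real tendsto_prod tendsto_diff
      tendsto_const tendsto_ext_fun)
  have "u \<in> C_g g X"
    unfolding in_C_g_iff
  proof (intro conjI ballI allI impI)
    fix x assume x: "x \<in> X"
    have "((\<lambda>x. w x / of_real (max 1 (norm (w x)))) \<longlongrightarrow> w x / of_real (max 1 (norm (w x)))) (atin X_top x)"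
      using cont[OF x]
      by (intro tendsto_divide tendsto_of_real tendsto_max tendsto_const tendsto_norm) auto
    moreover have "eventually (\<lambda>y. y \<in> X) (atin X_top x)"
      using x by (auto simp: eventually_atin intro: exI[of _ X])
    then have "eventually (\<lambda>y. w y / of_real (max 1 (norm (w y))) = u y) (atin X_top x)"
      by eventually_elim (simp add: u_def)
    ultimately show "(u \<longlongrightarrow> u x) (atin X_top x)"
      using x by (simp add: u_def[of x] tendsto_cong)
  qed (simp add: u_def)
  moreover have "norm (u x) \<le> 1" for x
    by (auto simp: u_def norm_divide divide_le_eq_1 max_def)
  moreover have "u t = s t" if "t \<in> T" for t
    using that T(1) w[OF that] s[OF that] by (auto simp: u_def max_def)
  ultimately show ?thesis by (rule that)
qed

lemma chebyshev_imp_unisolvent: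
  fixes B :: "(ext_pt \<Rightarrow> 'a::real_normed_field) set"
  assumes B: "fun_space.independent B" "finite B" and sub: "fun_space.span B \<subseteq> C_g g X"
    and cheb: "chebyshev_space (C_g g X) (sup_norm X) (fun_space.span B)"
  shows "unisolvent (fun_space.span B) (card B)"
proof (rule ccontr)
  let ?Y = "fun_space.span B"
  assume "\<not> unisolvent ?Y (card B)"
  then obtain T f where T: "T \<subseteq> X" "finite T" "card T = card B" "inj_on (ext_fun g) T"
    and f: "f \<in> ?Y" "\<forall>t\<in>T. f t = 0" "f \<noteq> 0"
    unfolding unisolvent_def by blast
  \<comment> \<open>With as many nodes as the dimension, a nontrivial kernel forces a proper image,
    and a proper image has a nontrivial annihilator \<open>a\<close>.\<close>
  have "\<not> inj_on (sample T id) ?Y"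
    using f by (auto simp: inj_on_sample_iff)
  then have "sample T id ` ?Y \<noteq> fun_space.span (unit_vec ` T)"
    using sample_inj_iff_surj[OF B T(2,3)] by blast
  moreover have "sample T id ` ?Y \<subseteq> fun_space.span (unit_vec ` T)"
    using sample_in_span[OF T(2)] by blast
  ultimately have proper: "sample T id ` ?Y \<subset> fun_space.span (unit_vec ` T)"
    by blast
  have "fun_space.subspace (sample T id ` ?Y)"
    by (rule fun_pair.linear_subspace_image[OF linear_sample fun_space.subspace_span])
  then obtain a i where a: "i \<in> T" "a i \<noteq> 0"
    "\<And>z. z \<in> sample T id ` ?Y \<Longrightarrow> (\<Sum>t\<in>T. a t * z t) = 0"
    using proper_subspace_annihilator[OF T(2) _ proper] by metis
  have annihilates: "(\<Sum>t\<in>T. a t * w t) = 0" if "w \<in> ?Y" for w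
    using a(3)[of "sample T id w"] that by (simp add: sample_def)
  have fC: "f \<in> C_g g X" using f(1) sub by auto
  obtain x where x: "f x \<noteq> 0" "x \<in> X"
    using f(3) C_g_outside[OF fC] by (metis ext zero_fun_apply)
  then have N: "0 < sup_norm X f"
    using norm_le_sup_norm[OF fC x(2)] by (meson less_le_trans zero_less_norm_iff)
  \<comment> \<open>Normalized so that \<open>|h| \<le> 1\<close>, which keeps the factor
    \<open>1 - |h|\<close> in \<open>v\<close> nonnegative on \<open>X\<close>.\<close>
  define h where "h = fun_scale (of_real (inverse (sup_norm X f))) f"
  have h: "h \<in> ?Y" "\<forall>t\<in>T. h t = 0" "h x \<noteq> 0"
    unfolding h_def using f N x by (auto intro: fun_space.span_scale)
  have hC: "h \<in> C_g g X" using h(1) sub by auto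
  have h_le: "norm (h y) \<le> 1" if "y \<in> X" for y
    using norm_le_sup_norm[OF fC that] N by (simp add: h_def norm_mult norm_inverse norm_divide field_simps)
  \<comment> \<open>The unimodular values are chosen so that \<open>a t * u t = |a t|\<close>; 0 is
    a harmless value where \<open>a t = 0\<close>.\<close>
  obtain u where u: "u \<in> C_g g X" "\<And>x. norm (u x) \<le> 1"
    "\<And>t. t \<in> T \<Longrightarrow> u t = (if a t = 0 then 0 else of_real (norm (a t)) / a t)"
    by (rule exists_bounded_interpolant[OF T(1,2,4),
          of "\<lambda>t. if a t = 0 then 0 else of_real (norm (a t)) / a t"]) (auto simp: norm_divide)
  define v where "v x = u x * of_real (1 - norm (h x))" for x
  have v: "v \<in> C_g g X"
    unfolding in_C_g_iff v_def using C_g_outside[OF u(1)]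
    by (auto intro!: tendsto_intros tendsto_C_g[OF u(1)] tendsto_C_g[OF hC])
  \<comment> \<open>Duality: pairing \<open>v - w\<close> with \<open>a\<close> removes
    \<open>w\<close> and leaves the sum of all \<open>|a t|\<close>, since \<open>h\<close> vanishes
    at the nodes. The same pairing is at most that sum times the norm of
    \<open>v - w\<close>.\<close>
  have lower: "1 \<le> sup_norm X (v - w)" if w: "w \<in> ?Y" for w
  proof -
    have vw: "v - w \<in> C_g g X" using v w sub by (auto intro: C_g_diff)
    have "(\<Sum>t\<in>T. a t * (v - w) t) = (\<Sum>t\<in>T. a t * v t)"
      using annihilates[OF w] by (simp add: right_diff_distrib sum_subtractf)
    also have "\<dots> = (\<Sum>t\<in>T. of_real (norm (a t)))"
      using h(2) by (intro sum.cong) (auto simp: v_def u(3))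
    also have "\<dots> = of_real (\<Sum>t\<in>T. norm (a t))"
      by simp
    finally have "norm (\<Sum>t\<in>T. a t * (v - w) t) = norm (of_real (\<Sum>t\<in>T. norm (a t)) :: 'a)"
      by (rule arg_cong)
    then have "(\<Sum>t\<in>T. norm (a t)) = norm (\<Sum>t\<in>T. a t * (v - w) t)"
      by (simp only: norm_of_real abs_of_nonneg sum_nonneg norm_ge_zero)
    also have "\<dots> \<le> (\<Sum>t\<in>T. norm (a t) * sup_norm X (v - w))"
      using norm_le_sup_norm[OF vw] T(1)
      by (intro sum_norm_le) (auto simp: norm_mult intro!: mult_left_mono)
    finally have "(\<Sum>t\<in>T. norm (a t)) * 1 \<le> (\<Sum>t\<in>T. norm (a t)) * sup_norm X (v - w)"
      by (simp add: sum_distrib_right)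
    moreover have "0 < (\<Sum>t\<in>T. norm (a t))"
      using a(1,2) T(2) by (intro sum_pos2[of T i]) auto
    ultimately show ?thesis by (simp only: mult_le_cancel_left_pos)
  qed
  have v_le: "norm (v y) \<le> 1 - norm (h y)" if "y \<in> X" for y
    using mult_right_mono[OF u(2)[of y], of "1 - norm (h y)"] h_le[OF that]
    by (simp add: v_def norm_mult del: of_real_diff)
  \<comment> \<open>The factor \<open>1 - |h|\<close> leaves exactly the room to subtract
    \<open>h\<close>.\<close>
  have upper: "sup_norm X (v - w) \<le> 1" if "w = 0 \<or> w = h" for w
  proof (rule sup_norm_le)
    fix y assume "y \<in> X"
    have "norm (v y - w y) \<le> norm (v y) + norm (w y)"
      by (rule norm_triangle_ineq4)
    also have "norm (w y) \<le> norm (h y)"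
      using that by auto
    finally show "norm ((v - w) y) \<le> 1"
      using v_le[OF \<open>y \<in> X\<close>] by simp
  qed simp
  have "(INF w\<in>?Y. sup_norm X (v - w)) = 1"
  proof (rule antisym)
    have "(INF w\<in>?Y. sup_norm X (v - w)) \<le> sup_norm X (v - h)"
      using lower h(1) by (intro cINF_lower bdd_belowI[of _ 1]) auto
    then show "(INF w\<in>?Y. sup_norm X (v - w)) \<le> 1"
      using upper[of h] by simp
    show "1 \<le> (INF w\<in>?Y. sup_norm X (v - w))"
      using lower h(1) by (intro cINF_greatest) auto
  qed
  then have best: "sup_norm X (v - w) = (INF w\<in>?Y. sup_norm X (v - w))" if "w \<in> ?Y" "w = 0 \<or> w = h" for w
    using lower[OF that(1)] upper[OF that(2)] by simp
  have "\<exists>!y. y \<in> ?Y \<and> sup_norm X (v - y) = (INF w\<in>?Y. sup_norm X (v - w))"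
    using cheb v unfolding chebyshev_space_def by blast
  then have "h = 0"
    using best[of 0] best[of h] h(1) fun_space.span_zero[of B] by blast
  then show False using h(3) by simp
qed

text \<open>A maximal independent subset of \<open>Y\<close> is finite, by comparison with a finite
  spanning set, so \<open>Y\<close> is the span of a finite basis and both implications
  apply.\<close>

lemma chebyshev_iff_g_haar:
  fixes Y :: "(ext_pt \<Rightarrow> 'a::{real_normed_field,euclidean_space}) set"
  assumes Y: "fun_space.subspace Y" "Y \<subseteq> C_g g X" "finite_dim Y"
  shows "chebyshev_space (C_g g X) (sup_norm X) Y \<longleftrightarrow> g_haar_space g X Y"
proof -
  obtain B where B: "B \<subseteq> Y" "fun_space.independent B" "Y \<subseteq> fun_space.span B"
    by (rule fun_space.maximal_independent_subset)
  then have span: "fun_space.span B = Y"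
    using Y(1) by (metis fun_space.span_subspace)
  obtain A where A: "finite A" "fun_space.span A = Y"
    using Y(3) by (auto simp: finite_dim_def)
  then have fin: "finite B"
    using fun_space.independent_span_bound[OF A(1) B(2)] B(1) by simp
  have sub: "fun_space.span B \<subseteq> C_g g X"
    using Y(2) span by simp
  show ?thesis
    using g_haar_space_iff_unisolvent[OF B(2) fin sub] unisolvent_imp_chebyshev[OF B(2) fin sub]
      chebyshev_imp_unisolvent[OF B(2) fin sub] span by auto
qed

end

theorem theorem6p7:
  fixes g :: "real \<Rightarrow> real" and X :: "ext_pt set"
  assumes "derivator g" and "compactin (g_topology g) X"
  shows "(\<forall>Y :: (ext_pt \<Rightarrow> real) set.
            fun_space.subspace Y \<and> Y \<subseteq> C_g g X \<and> finite_dim Y \<longrightarrow>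
            (chebyshev_space (C_g g X) (sup_norm X) Y \<longleftrightarrow> g_haar_space g X Y)) \<and>
         (\<forall>Y :: (ext_pt \<Rightarrow> complex) set.
            fun_space.subspace Y \<and> Y \<subseteq> C_g g X \<and> finite_dim Y \<longrightarrow>
            (chebyshev_space (C_g g X) (sup_norm X) Y \<longleftrightarrow> g_haar_space g X Y))"
proof -
  interpret compact_ext g X
    by unfold_locales (rule assms(2))
  show ?thesis
    by (intro conjI allI impI; elim conjE; rule chebyshev_iff_g_haar)
qed

end
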